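(* Let $A,M\in\mathbb{C}^{n\times n}$ with $M$ nonsingular, $b\in\mathbb{C}^n$, $\sigma\in\mathbb{C}$, and let $\mathcal{S}_1\subset\mathcal{S}_2\subset\cdots\subset\mathcal{S}_m\subset\mathcal{S}_{m+1}\subset\cdots$ be a nested sequence of subspaces of $\mathbb{C}^n$. Define $\mathcal{T}_m=(A+\sigma I)M^{-1}\mathcal{S}_m$ (and likewise $\mathcal{T}_{m+1}=(A+\sigma I)M^{-1}\mathcal{S}_{m+1}$). Let $r_0(\sigma)=b-(A+\sigma I)x_0(\sigma)$ be the initial residual for the shifted system $(A+\sigma I)x(\sigma)=b$ with initial approximation $x_0(\sigma)\in\mathbb{C}^n$, and let $\hat{r}_0(\sigma)$ be the residual produced by the minimum residual projection of $r_0(\sigma)$ over $\mathcal{S}_m$, that is, $$\hat{r}_0(\sigma)=r_0(\sigma)-(A+\sigma I)M^{-1}t_m(\sigma)\quad\text{with } t_m(\sigma)\in\mathcal{S}_m \text{ such that } \hat{r}_0(\sigma)\perp (A+\sigma I)M^{-1}\mathcal{S}_m.$$ Then $$\hat{r}_0(\sigma)=\bigl(I-P(\mathcal{T}_m)\bigr)P(\mathcal{T}_{m+1})\,r_0(\sigma)+\bigl(I-P(\mathcal{T}_{m+1})\bigr)r_0(\sigma).$$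
   Context: For a subspace $\mathcal{V}\subseteq\mathbb{C}^n$, $P(\mathcal{V})$ denotes the orthogonal projector (with respect to the Euclidean inner product) onto $\mathcal{V}$, and $\perp$ refers to the Euclidean inner product. $M$ is a right preconditioner: the shifted system is treated in the form $(A+\sigma I)M^{-1}w(\sigma)=b$ with $w(\sigma)=Mx(\sigma)$, and corrections are applied to $w_0(\sigma)=Mx_0(\sigma)$. *)

theory Defs
  imports "HOL-Analysis.Analysis"
begin

text \<open>The Euclidean inner product of \<open>\<complex>\<^sup>n\<close>, complex valued. The library inner product on
  \<^typ>\<open>complex ^ 'n\<close> is its real part. Likewise, complex subspaces are \<^const>\<open>vec.subspace\<close>;
  the type class constant \<^const>\<open>subspace\<close> means real subspaces.\<close>

definition cinner :: "complex ^ 'n \<Rightarrow> complex ^ 'n \<Rightarrow> complex"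
  where "cinner x y = (\<Sum>i\<in>UNIV. x $ i * cnj (y $ i))"

definition is_orth_projector :: "(complex ^ 'n) set \<Rightarrow> complex ^ 'n ^ 'n \<Rightarrow> bool"
  where "is_orth_projector V P \<longleftrightarrow>
    (\<forall>x. P *v x \<in> V \<and> (\<forall>v\<in>V. cinner (x - P *v x) v = 0))"

text \<open>The orthogonal projector as a matrix. The description is meaningful for complex subspaces,
  by \<open>ex1_orth_projector\<close> below.\<close>

definition orth_projector :: "(complex ^ 'n) set \<Rightarrow> complex ^ 'n ^ 'n"
  where "orth_projector V = (THE P. is_orth_projector V P)"

lemma inner_eq_Re_cinner: "x \<bullet> y = Re (cinner x y)"
  by (simp add: cinner_def inner_vec_def inner_complex_def)

lemma cinner_scale_right: "cinner x (c *s y) = cnj c * cinner x y"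
  by (simp add: cinner_def sum_distrib_left algebra_simps)

lemma cinner_diff_left: "cinner (x - y) z = cinner x z - cinner y z"
  by (simp add: cinner_def sum_subtractf algebra_simps)

lemma cinner_add_left: "cinner (x + y) z = cinner x z + cinner y z"
  by (simp add: cinner_def sum.distrib algebra_simps)

lemma cinner_scale_left: "cinner (c *s x) z = c * cinner x z"
  by (simp add: cinner_def sum_distrib_left algebra_simps)

lemma cinner_self_eq_0: "cinner x x = 0 \<Longrightarrow> x = 0"
  using inner_eq_Re_cinner[of x x] by simp

lemma real_subspace_of_complex:
  fixes V :: "(complex ^ 'n) set"
  assumes "vec.subspace V"
  shows "subspace V"
proof (rule subspaceI)
  fix c :: real and x assume "x \<in> V"
  moreover have "c *\<^sub>R x = complex_of_real c *s x"
    unfolding vec_eq_iff by (simp add: scaleR_conv_of_real[where 'a = complex])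
  ultimately show "c *\<^sub>R x \<in> V" using assms vec.subspace_scale by metis
qed (use assms vec.subspace_0 vec.subspace_add in blast)+

lemma ex1_orth_projection:
  fixes V :: "(complex ^ 'n) set"
  assumes V: "vec.subspace V"
  shows "\<exists>!p. p \<in> V \<and> (\<forall>v\<in>V. cinner (x - p) v = 0)"
proof -
  obtain p z where p: "p \<in> span V" and z: "\<And>w. w \<in> span V \<Longrightarrow> orthogonal z w" and x: "x = p + z"
    using orthogonal_subspace_decomp_exists[of V x] by metis
  have sp: "span V = V" using real_subspace_of_complex[OF V] by simp
  have "cinner (x - p) v = 0" if v: "v \<in> V" for v
  proof -
    have "Re (cinner z v) = 0"
      using z[of v] v unfolding sp by (simp add: orthogonal_def inner_eq_Re_cinner)
    moreover have "\<i> *s v \<in> V" using V v by (rule vec.subspace_scale)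
    then have "Re (cinner z (\<i> *s v)) = 0"
      using z unfolding sp by (simp add: orthogonal_def inner_eq_Re_cinner)
    ultimately show ?thesis by (simp add: x cinner_scale_right complex_eq_iff)
  qed
  moreover have "q = p" if q: "q \<in> V" "\<forall>v\<in>V. cinner (x - q) v = 0"
    and p': "p \<in> V" "\<forall>v\<in>V. cinner (x - p) v = 0" for q
  proof -
    have d: "q - p \<in> V" using V q p' by (intro vec.subspace_diff)
    have "cinner (q - p) (q - p) = cinner (x - p) (q - p) - cinner (x - q) (q - p)"
      by (simp add: cinner_diff_left)
    also have "\<dots> = 0" using d q p' by simp
    finally show ?thesis using cinner_self_eq_0 by force
  qed
  ultimately show ?thesis using p unfolding sp by blast
qed

lemma ex1_orth_projector:
  fixes V :: "(complex ^ 'n) set"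
  assumes V: "vec.subspace V"
  shows "\<exists>!P. is_orth_projector V P"
proof -
  define f where "f x = (THE p. p \<in> V \<and> (\<forall>v\<in>V. cinner (x - p) v = 0))" for x
  have f: "f x \<in> V \<and> (\<forall>v\<in>V. cinner (x - f x) v = 0)" for x
    unfolding f_def by (rule theI'[OF ex1_orth_projection[OF V]])
  have fI: "p = f x" if "p \<in> V \<and> (\<forall>v\<in>V. cinner (x - p) v = 0)" for p x
    using ex1_orth_projection[OF V, of x] f that by blast
  have "Vector_Spaces.linear (*s) (*s) f"
  proof (rule Vector_Spaces.linear_iff[THEN iffD2], intro conjI allI)
    show "f (x + y) = f x + f y" for x y
    proof (rule fI[symmetric], intro conjI ballI)
      show "f x + f y \<in> V" using V f by (intro vec.subspace_add) auto
      fix v assume v: "v \<in> V"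
      have "x + y - (f x + f y) = (x - f x) + (y - f y)" by simp
      then show "cinner (x + y - (f x + f y)) v = 0" using f v by (metis cinner_add_left add_0)
    qed
    show "f (c *s x) = c *s f x" for c x
    proof (rule fI[symmetric], intro conjI ballI)
      show "c *s f x \<in> V" using V f by (intro vec.subspace_scale) auto
      fix v assume v: "v \<in> V"
      have "c *s x - c *s f x = c *s (x - f x)" by (simp add: vec.scale_right_diff_distrib)
      then show "cinner (c *s x - c *s f x) v = 0"
        using f v by (metis cinner_scale_left mult_zero_right)
    qed
  qed unfold_locales
  then have mf: "matrix f *v x = f x" for x by (rule matrix_works)
  show ?thesis
  proof (rule ex1I)
    show "is_orth_projector V (matrix f)" unfolding is_orth_projector_def mf using f by blast
    fix P assume "is_orth_projector V P"
    then have "P *v x = f x" for x using fI unfolding is_orth_projector_def by blast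
    then show "P = matrix f" by (simp add: matrix_eq mf)
  qed
qed

end

theory Submission
  imports Defs
begin

text \<open>Minimising the residual over \<open>S\<^sub>m\<close> makes the correction \<open>r\<^sub>0 - rhat\<^sub>0\<close> an element of
  \<open>T\<^sub>m\<close> whose error is orthogonal to \<open>T\<^sub>m\<close>; so it is the orthogonal projection of \<open>r\<^sub>0\<close>, and
  \<open>rhat\<^sub>0 = (I - P(T\<^sub>m)) r\<^sub>0\<close> (\<open>orth_projector_eqI\<close>). The formula splits \<open>r\<^sub>0\<close> along
  the larger space \<open>T\<^sub>m\<^sub>+\<^sub>1\<close>: because \<open>T\<^sub>m \<subseteq> T\<^sub>m\<^sub>+\<^sub>1\<close>, the part of \<open>r\<^sub>0\<close> orthogonal to
  \<open>T\<^sub>m\<^sub>+\<^sub>1\<close> is invisible to \<open>P(T\<^sub>m)\<close>, that is, \<open>P(T\<^sub>m) P(T\<^sub>m\<^sub>+\<^sub>1) = P(T\<^sub>m)\<close>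
  (\<open>orth_projector_nested\<close>). Expanding the right-hand side with this identity leaves
  \<open>(I - P(T\<^sub>m)) r\<^sub>0\<close>.\<close>

lemma is_orth_projector_orth_projector:
  fixes V :: "(complex ^ 'n) set"
  assumes "vec.subspace V"
  shows "is_orth_projector V (orth_projector V)"
  unfolding orth_projector_def by (rule theI'[OF ex1_orth_projector[OF assms]])

lemma orth_projector_eqI:
  fixes V :: "(complex ^ 'n) set"
  assumes "vec.subspace V" "p \<in> V" "\<And>v. v \<in> V \<Longrightarrow> cinner (x - p) v = 0"
  shows "orth_projector V *v x = p"
  using is_orth_projector_orth_projector[OF assms(1)] ex1_orth_projection[OF assms(1), of x] assms(2,3)
  unfolding is_orth_projector_def by blast

text \<open>The vector \<open>P(V) x\<close> is also the projection onto \<open>V\<close> of \<open>P(W) x\<close>: the two errors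
  \<open>x - P(V) x\<close> and \<open>x - P(W) x\<close> are both orthogonal to \<open>V\<close>, and so is their difference
  \<open>P(W) x - P(V) x\<close>.\<close>

lemma orth_projector_nested:
  fixes V W :: "(complex ^ 'n) set"
  assumes V: "vec.subspace V" and W: "vec.subspace W" and "V \<subseteq> W"
  shows "orth_projector V *v (orth_projector W *v x) = orth_projector V *v x"
proof (rule orth_projector_eqI[OF V])
  have PV: "orth_projector V *v x \<in> V"
      "\<And>v. v \<in> V \<Longrightarrow> cinner (x - orth_projector V *v x) v = 0"
    using is_orth_projector_orth_projector[OF V] by (auto simp: is_orth_projector_def)
  have PW: "\<And>v. v \<in> W \<Longrightarrow> cinner (x - orth_projector W *v x) v = 0"
    using is_orth_projector_orth_projector[OF W] by (auto simp: is_orth_projector_def)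
  show "orth_projector V *v x \<in> V" by (rule PV)
  show "cinner (orth_projector W *v x - orth_projector V *v x) v = 0" if "v \<in> V" for v
    using PV(2)[OF that] PW[of v] that \<open>V \<subseteq> W\<close> by (auto simp: cinner_diff_left)
qed

theorem theorem5p2:
  fixes A M :: "complex ^ 'n ^ 'n" and b x0 r0 rhat0 t :: "complex ^ 'n"
    and \<sigma> :: complex and S T :: "nat \<Rightarrow> (complex ^ 'n) set" and m :: nat
  assumes "invertible M"
    and "\<And>k. k \<ge> 1 \<Longrightarrow> vec.subspace (S k)"
    and "\<And>k. k \<ge> 1 \<Longrightarrow> S k \<subseteq> S (k + 1)"
    and "m \<ge> 1"
    and "\<And>k. k \<ge> 1 \<Longrightarrow> T k = (\<lambda>s. ((A + mat \<sigma>) ** matrix_inv M) *v s) ` S k"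
    and "r0 = b - (A + mat \<sigma>) *v x0"
    and "t \<in> S m"
    and "rhat0 = r0 - ((A + mat \<sigma>) ** matrix_inv M) *v t"
    and "\<forall>v \<in> (\<lambda>s. ((A + mat \<sigma>) ** matrix_inv M) *v s) ` S m. cinner rhat0 v = 0"
  shows "rhat0 = ((mat 1 - orth_projector (T m)) ** orth_projector (T (m + 1))) *v r0
                 + (mat 1 - orth_projector (T (m + 1))) *v r0"
proof -
  define B where "B = (A + mat \<sigma>) ** matrix_inv M"
  have T: "T k = (*v) B ` S k" if "k \<ge> 1" for k
    using assms(5)[OF that] by (simp add: B_def)
  have sub: "vec.subspace (T k)" if "k \<ge> 1" for k
    unfolding T[OF that] using matrix_vector_mul_linear_gen assms(2)[OF that]
    by (rule vec.linear_subspace_image)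
  have nested: "T m \<subseteq> T (m + 1)"
    using T assms(3,4) by (simp add: image_mono)
  have "orth_projector (T m) *v r0 = B *v t"
  proof (rule orth_projector_eqI[OF sub[OF assms(4)]])
    show "B *v t \<in> T m" using T assms(4,7) by simp
    show "cinner (r0 - B *v t) v = 0" if "v \<in> T m" for v
      using that assms(8,9) T[OF assms(4)] by (auto simp: B_def)
  qed
  then have "rhat0 = r0 - orth_projector (T m) *v r0"
    using assms(8) by (simp add: B_def)
  then show ?thesis
    using orth_projector_nested[OF sub[OF assms(4)] sub nested, of r0]
    by (simp add: matrix_vector_mul_assoc[symmetric] matrix_vector_mult_diff_rdistrib)
qed

end
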